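(* Let $C_1,\ldots,C_m\in\mathbb{C}^{n\times n}$ be Hermitian matrices. The following conditions are equivalent: (i) $C_1,\ldots,C_m$ are SDC. (ii) There exists a nonsingular matrix $P\in\mathbb{C}^{n\times n}$ such that $P^*C_1P,\ldots,P^*C_mP$ pairwise commute. (iii) There exists a positive definite Hermitian matrix $Q=Q^*\in\mathbb{C}^{n\times n}$ such that $QC_1Q,\ldots,QC_mQ$ pairwise commute. (iv) There exists a positive definite Hermitian matrix $X=X^*\in\mathbb{C}^{n\times n}$ that solves the following system of $\frac{m(m-1)}{2}$ linear equations: $$C_iXC_j=C_jXC_i,\quad \forall\, 1\le i<j\le m.$$ Moreover, if $C_1,\ldots,C_m$ are all real, then all the other matrices in the statement can be taken real: the equivalence of (i)–(iv) also holds with the diagonalizing congruence matrix in (i) and the matrices $P$, $Q$, $X$ in (ii), (iii), (iv) required to be real, and each of these real conditions is equivalent to the corresponding complex one.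
   Context: $P^*$ denotes the conjugate transpose of $P$. Hermitian matrices $C_1,\ldots,C_m\in\mathbb{C}^{n\times n}$ are called SDC (simultaneously diagonalizable via $*$-congruence) if there exists a nonsingular matrix $P\in\mathbb{C}^{n\times n}$ such that $P^*C_iP$ is diagonal for every $i=1,\ldots,m$. *)

theory Defs
  imports "Jordan_Normal_Form.Schur_Decomposition"
begin

definition hermitian_mat :: "complex mat \<Rightarrow> bool" where
  "hermitian_mat A \<longleftrightarrow> mat_adjoint A = A"

(* The strict order on complex numbers is the one of HOL-Library.Complex_Order:
   0 < z means that z is real and positive. *)
definition positive_definite_mat :: "nat \<Rightarrow> complex mat \<Rightarrow> bool" where
  "positive_definite_mat n A \<longleftrightarrow>
     A \<in> carrier_mat n n \<and> hermitian_mat A \<and>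
     (\<forall>v \<in> carrier_vec n. v \<noteq> 0\<^sub>v n \<longrightarrow> 0 < (A *\<^sub>v v) \<bullet>c v)"

definition real_mat :: "complex mat \<Rightarrow> bool" where
  "real_mat A \<longleftrightarrow> elements_mat A \<subseteq> \<real>"

definition pairwise_commute :: "nat \<Rightarrow> (nat \<Rightarrow> complex mat) \<Rightarrow> bool" where
  "pairwise_commute m A \<longleftrightarrow> (\<forall>i \<in> {1..m}. \<forall>j \<in> {1..m}. A i * A j = A j * A i)"

definition diagonalizing_congruence ::
  "nat \<Rightarrow> nat \<Rightarrow> (nat \<Rightarrow> complex mat) \<Rightarrow> complex mat \<Rightarrow> bool" where
  "diagonalizing_congruence n m C P \<longleftrightarrow>
     P \<in> carrier_mat n n \<and> invertible_mat P \<and>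
     (\<forall>i \<in> {1..m}. diagonal_mat (mat_adjoint P * C i * P))"

definition SDC :: "nat \<Rightarrow> nat \<Rightarrow> (nat \<Rightarrow> complex mat) \<Rightarrow> bool" where
  "SDC n m C \<longleftrightarrow> (\<exists>P. diagonalizing_congruence n m C P)"

end

theory Submission imports Defs begin

text \<open>
  Everything follows from the identity
  $(P^* C_i P)(P^* C_j P) = P^* (C_i X C_j) P$ with $X = P P^*$. If the congruences by $P$
  commute, then $X$, which is positive definite, solves the linear system
  (\<open>commuting_congruences_imp_linear_equation\<close>). Conversely a positive definite solution
  $X$ has a positive definite square root $Q$ (\<open>positive_definite_sqrt\<close>), and the same
  identity with $P = Q = Q^*$ shows that the matrices $Q C_i Q$ commute. These are Hermitian, hence
  diagonalized by one unitary $U$ (\<open>simultaneous_unitary_diagonalization\<close>), so that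
  $Q U$ is a diagonalizing congruence for the $C_i$ themselves.

  What remains is the spectral theorem for a finite commuting family of Hermitian
  matrices. It is proved by extending orthonormal systems of common eigenvectors one vector at a
  time, inside the orthogonal complement of the vectors already found
  (\<open>common_eigenvector_in_invariant_subspace\<close>).

  For the real version the whole argument is carried out over a set of scalars $K$ that is either
  the reals or all complex numbers. Apart from closure properties of $K$, the real case needs an
  argument of its own only in the choice of a common eigenvector, which can be made real by passing from $u$ to $u + \bar u$ or to
  $\mathrm{i}\,u$ (\<open>common_eigenvector_real\<close>). This gives the equivalence of the four
  real conditions with each other. They are linked to the complex ones through the linear system: if
  its coefficients are real, then with $X$ also $X + \bar X$ is a positive definite solution
  (\<open>real_positive_definite_solution\<close>).
\<close>

section \<open>The conjugate transpose\<close>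

lemma mat_adjoint_carrier:
  "A \<in> carrier_mat nr nc \<Longrightarrow> mat_adjoint A \<in> carrier_mat nc nr"
  unfolding mat_adjoint_def by auto

lemma mat_adjoint_index:
  assumes "A \<in> carrier_mat nr nc" "i < nc" "j < nr"
  shows "mat_adjoint A $$ (i,j) = conjugate (A $$ (j,i))"
  using assms unfolding mat_adjoint_def by (auto simp: mat_of_rows_index)

lemma mat_adjoint_mult:
  fixes A B :: "complex mat"
  assumes "A \<in> carrier_mat nr n" "B \<in> carrier_mat n nc"
  shows "mat_adjoint (A * B) = mat_adjoint B * mat_adjoint A"
proof (rule eq_matI)
  have d: "dim_row (mat_adjoint A) = n" "dim_col (mat_adjoint A) = nr"
    "dim_row (mat_adjoint B) = nc" "dim_col (mat_adjoint B) = n"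
    using mat_adjoint_carrier[OF assms(1)] mat_adjoint_carrier[OF assms(2)]
    unfolding carrier_mat_def by blast+
  note AB = mult_carrier_mat[OF assms]
  fix i j assume ij: "i < dim_row (mat_adjoint B * mat_adjoint A)" "j < dim_col (mat_adjoint B * mat_adjoint A)"
  then have ij: "i < nc" "j < nr" using d by auto
  show "mat_adjoint (A * B) $$ (i, j) = (mat_adjoint B * mat_adjoint A) $$ (i,j)"
    using ij assms d
    by (simp add: mat_adjoint_index[OF AB] scalar_prod_def conjugate_complex_def
        mat_adjoint_index[OF assms(1)] mat_adjoint_index[OF assms(2)] mult.commute)
qed (use assms mat_adjoint_carrier[OF mult_carrier_mat[OF assms]]
       mat_adjoint_carrier[OF assms(1)] mat_adjoint_carrier[OF assms(2)] in auto)

lemma mat_adjoint_adjoint: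
  fixes A :: "complex mat"
  shows "mat_adjoint (mat_adjoint A) = A"
proof -
  have A: "A \<in> carrier_mat (dim_row A) (dim_col A)" by simp
  note A' = mat_adjoint_carrier[OF A]
  show ?thesis
    by (rule eq_matI)
      (use mat_adjoint_carrier[OF A'] in \<open>auto simp: mat_adjoint_index[OF A'] mat_adjoint_index[OF A]\<close>)
qed

lemma mat_adjoint_one: "mat_adjoint (1\<^sub>m n :: complex mat) = 1\<^sub>m n"
proof -
  have A: "(1\<^sub>m n :: complex mat) \<in> carrier_mat n n" by simp
  show ?thesis
    by (rule eq_matI)
      (use mat_adjoint_carrier[OF A] in \<open>auto simp: mat_adjoint_index[OF A]\<close>)
qed

lemma cscalar_prod_adjoint:
  fixes A :: "complex mat"
  assumes A: "A \<in> carrier_mat nr nc" and x: "x \<in> carrier_vec nc" and y: "y \<in> carrier_vec nr"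
  shows "(A *\<^sub>v x) \<bullet>c y = x \<bullet>c (mat_adjoint A *\<^sub>v y)"
proof -
  note A' = mat_adjoint_carrier[OF A]
  have "(A *\<^sub>v x) \<bullet>c y = (\<Sum>i<nr. \<Sum>j<nc. A $$ (i,j) * x $ j * cnj (y $ i))"
    using A x y by (simp add: scalar_prod_def sum_distrib_right atLeast0LessThan conjugate_complex_def)
  also have "\<dots> = (\<Sum>j<nc. \<Sum>i<nr. A $$ (i,j) * x $ j * cnj (y $ i))"
    by (rule sum.swap)
  also have "\<dots> = x \<bullet>c (mat_adjoint A *\<^sub>v y)"
    using A' x y by (simp add: scalar_prod_def sum_distrib_left atLeast0LessThan
        conjugate_complex_def mat_adjoint_index[OF A] mult_ac)
  finally show ?thesis .
qed

lemma hermitian_cscalar_prod: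
  assumes "A \<in> carrier_mat n n" "hermitian_mat A" "x \<in> carrier_vec n" "y \<in> carrier_vec n"
  shows "(A *\<^sub>v x) \<bullet>c y = x \<bullet>c (A *\<^sub>v y)"
  using cscalar_prod_adjoint[OF assms(1,3,4)] assms(2) by (simp add: hermitian_mat_def)

lemma hermitian_congruence:
  assumes "A \<in> carrier_mat n n" "hermitian_mat A" "P \<in> carrier_mat n n"
  shows "hermitian_mat (mat_adjoint P * A * P)"
  using assms mat_adjoint_carrier[OF assms(3)]
  by (simp add: hermitian_mat_def mat_adjoint_mult[of _ n n _ n] mat_adjoint_adjoint assoc_mult_mat[of _ n n _ n _ n])

section \<open>Eigenvectors in invariant subspaces\<close>

definition vec_subspace :: "nat \<Rightarrow> complex vec set \<Rightarrow> bool" where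
  "vec_subspace n W \<longleftrightarrow> W \<subseteq> carrier_vec n \<and> 0\<^sub>v n \<in> W \<and>
     (\<forall>x\<in>W. \<forall>y\<in>W. x + y \<in> W) \<and> (\<forall>c. \<forall>x\<in>W. c \<cdot>\<^sub>v x \<in> W)"

lemma smult_vec_eq_0_iff:
  fixes v :: "'a :: field vec"
  assumes "v \<in> carrier_vec n"
  shows "c \<cdot>\<^sub>v v = 0\<^sub>v n \<longleftrightarrow> c = 0 \<or> v = 0\<^sub>v n"
proof
  assume 0: "c \<cdot>\<^sub>v v = 0\<^sub>v n"
  show "c = 0 \<or> v = 0\<^sub>v n"
  proof (cases "c = 0")
    case False
    then have "v = inverse c \<cdot>\<^sub>v (c \<cdot>\<^sub>v v)" by (simp add: smult_smult_assoc)
    moreover have "inverse c \<cdot>\<^sub>v 0\<^sub>v n = (0\<^sub>v n :: 'a vec)" by auto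
    ultimately show ?thesis by (simp add: 0)
  qed simp
qed (use assms in auto)

text \<open>The vector $p(A)\,w$, evaluated by Horner's rule: arguments about it become inductions on
  $p$, and matrix powers do not occur.\<close>
definition poly_mat_vec :: "complex mat \<Rightarrow> complex vec \<Rightarrow> complex poly \<Rightarrow> complex vec" where
  "poly_mat_vec A w p = fold_coeffs (\<lambda>a v. a \<cdot>\<^sub>v w + A *\<^sub>v v) p (0\<^sub>v (dim_vec w))"

context
  fixes A :: "complex mat" and w :: "complex vec" and n :: nat
  assumes A: "A \<in> carrier_mat n n" and w: "w \<in> carrier_vec n"
begin

lemma poly_mat_vec_0: "poly_mat_vec A w 0 = 0\<^sub>v n"
  using w by (simp add: poly_mat_vec_def)

lemma poly_mat_vec_pCons: "poly_mat_vec A w (pCons a p) = a \<cdot>\<^sub>v w + A *\<^sub>v poly_mat_vec A w p"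
proof (cases "a = 0 \<and> p = 0")
  case True
  then show ?thesis using A w by (auto simp: poly_mat_vec_0)
next
  case False
  then show ?thesis unfolding poly_mat_vec_def
    by (cases "p = 0") (simp_all add: fold_coeffs_pCons_coeff_not_0_eq fold_coeffs_pCons_not_0_0_eq)
qed

lemma poly_mat_vec_in_subspace:
  assumes W: "vec_subspace n W" "\<And>x. x \<in> W \<Longrightarrow> A *\<^sub>v x \<in> W" "w \<in> W"
  shows "poly_mat_vec A w p \<in> W"
  using W by (induction p) (auto simp: poly_mat_vec_0 poly_mat_vec_pCons vec_subspace_def)

lemma poly_mat_vec_carrier: "poly_mat_vec A w p \<in> carrier_vec n"
  using A w by (induction p) (auto simp: poly_mat_vec_0 poly_mat_vec_pCons)

lemma poly_mat_vec_add: "poly_mat_vec A w (p + q) = poly_mat_vec A w p + poly_mat_vec A w q"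
proof (induction p q rule: poly_induct2)
  case 0
  then show ?case by (simp add: poly_mat_vec_0)
next
  case (pCons a p b q)
  have "A *\<^sub>v (poly_mat_vec A w p + poly_mat_vec A w q) = A *\<^sub>v poly_mat_vec A w p + A *\<^sub>v poly_mat_vec A w q"
    using A poly_mat_vec_carrier by (simp add: mult_add_distrib_mat_vec)
  then show ?case
    using A w pCons poly_mat_vec_carrier[of p] poly_mat_vec_carrier[of q]
    by (intro eq_vecI) (auto simp add: poly_mat_vec_pCons algebra_simps)
qed

lemma poly_mat_vec_smult: "poly_mat_vec A w (smult c p) = c \<cdot>\<^sub>v poly_mat_vec A w p"
proof (induction p)
  case 0
  then show ?case by (auto simp: poly_mat_vec_0)
next
  case (pCons a p)
  have "A *\<^sub>v (c \<cdot>\<^sub>v poly_mat_vec A w p) = c \<cdot>\<^sub>v (A *\<^sub>v poly_mat_vec A w p)"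
    using A poly_mat_vec_carrier by (simp add: mult_mat_vec)
  then show ?case
    using A w pCons poly_mat_vec_carrier[of p]
    by (intro eq_vecI) (auto simp add: poly_mat_vec_pCons algebra_simps)
qed

lemma poly_mat_vec_linear_factor:
  "A *\<^sub>v poly_mat_vec A w q = poly_mat_vec A w ([:- c, 1:] * q) + c \<cdot>\<^sub>v poly_mat_vec A w q"
proof -
  have "A *\<^sub>v poly_mat_vec A w q = poly_mat_vec A w (pCons 0 q)"
    using A w mult_mat_vec_carrier[OF A poly_mat_vec_carrier[of q]]
    by (auto simp: poly_mat_vec_pCons)
  also have "pCons 0 q = [:- c, 1:] * q + smult c q" by simp
  finally show ?thesis by (simp only: poly_mat_vec_add poly_mat_vec_smult)
qed

lemma poly_mat_vec_monom: "poly_mat_vec A w (monom c j) = c \<cdot>\<^sub>v poly_mat_vec A w (monom 1 j)"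
  by (simp flip: poly_mat_vec_smult add: smult_monom)

lemma poly_mat_vec_sum_index:
  assumes "i < n" "finite J"
  shows "poly_mat_vec A w (\<Sum>j\<in>J. f j) $ i = (\<Sum>j\<in>J. poly_mat_vec A w (f j) $ i)"
  using assms(2)
proof (induction J rule: finite_induct)
  case empty
  then show ?case using \<open>i < n\<close> by (simp add: poly_mat_vec_0)
next
  case (insert x F)
  have "dim_vec (poly_mat_vec A w p) = n" for p using poly_mat_vec_carrier[of p] by simp
  with insert show ?case using \<open>i < n\<close> by (simp add: poly_mat_vec_add)
qed

text \<open>The $n+1$ vectors $w, A w, \ldots, A^n w$ lie in an $n$-dimensional space, so they are linearly
  dependent, and a dependency is a polynomial.\<close>
lemma annihilating_poly_exists: "\<exists>p. p \<noteq> 0 \<and> poly_mat_vec A w p = 0\<^sub>v n"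
proof -
  \<comment> \<open>The columns are the vectors $A^j w$; the extra zero row makes the matrix square and singular,
    so that a kernel vector, which is the dependency, comes from the vanishing determinant.\<close>
  define M where "M = mat (Suc n) (Suc n)
    (\<lambda>(i,j). if i < n then poly_mat_vec A w (monom 1 j) $ i else 0)"
  have M: "M \<in> carrier_mat (Suc n) (Suc n)" by (simp add: M_def)
  have "det M = (\<Sum>j<Suc n. M $$ (n,j) * cofactor M n j)"
    using laplace_expansion_row[OF M, of n] by simp
  also have "\<dots> = 0" by (intro sum.neutral) (auto simp: M_def)
  finally have "det M = 0" .
  then obtain v where v: "v \<in> carrier_vec (Suc n)" "v \<noteq> 0\<^sub>v (Suc n)" "M *\<^sub>v v = 0\<^sub>v (Suc n)"
    using det_0_iff_vec_prod_zero[OF M] by blast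
  define p where "p = (\<Sum>j<Suc n. monom (v $ j) j)"
  have coeff_p: "coeff p j = v $ j" if "j < Suc n" for j
    using that by (simp add: p_def coeff_sum del: sum.lessThan_Suc)
  have "p \<noteq> 0"
  proof
    assume "p = 0"
    then have "v = 0\<^sub>v (Suc n)" using coeff_p v(1) by (intro eq_vecI) auto
    with v(2) show False ..
  qed
  moreover have "poly_mat_vec A w p = 0\<^sub>v n"
  proof (rule eq_vecI)
    fix i assume "i < dim_vec (0\<^sub>v n :: complex vec)"
    then have i: "i < n" by simp
    have "poly_mat_vec A w p $ i = (\<Sum>j<Suc n. v $ j * poly_mat_vec A w (monom 1 j) $ i)"
      unfolding p_def poly_mat_vec_sum_index[OF i finite_lessThan]
      using i carrier_vecD[OF poly_mat_vec_carrier]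
      by (subst poly_mat_vec_monom) (simp del: sum.lessThan_Suc)
    also have "\<dots> = (M *\<^sub>v v) $ i"
      using i v(1) by (simp add: M_def scalar_prod_def atLeast0LessThan mult.commute del: sum.lessThan_Suc)
    finally show "poly_mat_vec A w p $ i = 0\<^sub>v n $ i" using v(3) i by simp
  qed (use poly_mat_vec_carrier in simp)
  ultimately show ?thesis by blast
qed

text \<open>Let $p$ be a nonzero polynomial of least degree with $p(A)\,w = 0$, and let $c$ be a complex root,
  $p = (x - c)\,q$. Then $q(A)\,w$ is nonzero by minimality and is killed by $A - c$. It lies in every
  $A$-invariant subspace that contains $w$; this is what makes the argument work inside $W$ without
  choosing a basis of $W$.\<close>
lemma eigenvector_in_invariant_subspace:
  assumes W: "vec_subspace n W" "\<And>x. x \<in> W \<Longrightarrow> A *\<^sub>v x \<in> W" "w \<in> W"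
    and w0: "w \<noteq> 0\<^sub>v n"
  shows "\<exists>u\<in>W. u \<noteq> 0\<^sub>v n \<and> (\<exists>c. A *\<^sub>v u = c \<cdot>\<^sub>v u)"
proof -
  obtain p where p: "p \<noteq> 0" "poly_mat_vec A w p = 0\<^sub>v n"
    and min: "\<And>q. q \<noteq> 0 \<Longrightarrow> poly_mat_vec A w q = 0\<^sub>v n \<Longrightarrow> degree p \<le> degree q"
    using ex_has_least_nat[of "\<lambda>p. p \<noteq> 0 \<and> poly_mat_vec A w p = 0\<^sub>v n" _ degree] annihilating_poly_exists
    by blast
  have "degree p \<noteq> 0"
  proof
    assume "degree p = 0"
    then obtain a where a: "p = [:a:]" by (rule degree_eq_zeroE)
    moreover have "A *\<^sub>v 0\<^sub>v n = 0\<^sub>v n" using A by auto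
    ultimately have "a \<cdot>\<^sub>v w = 0\<^sub>v n" "a \<noteq> 0"
      using p A w by (simp_all add: poly_mat_vec_pCons poly_mat_vec_0)
    then have "w = 0\<^sub>v n" using w by (simp add: smult_vec_eq_0_iff)
    with w0 show False ..
  qed
  then obtain c where "poly p c = 0"
    using fundamental_theorem_of_algebra[of p] by (auto simp: constant_degree)
  then obtain q where q: "p = [:- c, 1:] * q" by (auto simp: poly_eq_0_iff_dvd)
  with p(1) have "q \<noteq> 0" by auto
  then have "degree p = Suc (degree q)" unfolding q by (subst degree_mult_eq) auto
  then have "poly_mat_vec A w q \<noteq> 0\<^sub>v n" using min[of q] \<open>q \<noteq> 0\<close> by auto
  moreover have "A *\<^sub>v poly_mat_vec A w q = c \<cdot>\<^sub>v poly_mat_vec A w q"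
    using poly_mat_vec_linear_factor[of q c] p(2) poly_mat_vec_carrier[of q] by (simp add: q)
  ultimately show ?thesis using poly_mat_vec_in_subspace[OF W] by blast
qed

end

text \<open>Induction on the family: the vectors of $W$ that are eigenvectors of the matrices treated so far,
  for fixed eigenvalues, form a subspace, and each further matrix leaves it invariant because it
  commutes with the others.\<close>
lemma common_eigenvector_in_invariant_subspace:
  fixes A :: "'i \<Rightarrow> complex mat"
  assumes "finite I" and A: "\<And>i. i \<in> I \<Longrightarrow> A i \<in> carrier_mat n n"
    and comm: "\<And>i j. i \<in> I \<Longrightarrow> j \<in> I \<Longrightarrow> A i * A j = A j * A i"
    and W: "vec_subspace n W" "\<And>i x. i \<in> I \<Longrightarrow> x \<in> W \<Longrightarrow> A i *\<^sub>v x \<in> W"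
    and w: "w \<in> W" "w \<noteq> 0\<^sub>v n"
  shows "\<exists>u\<in>W. u \<noteq> 0\<^sub>v n \<and> (\<exists>c. \<forall>i\<in>I. A i *\<^sub>v u = c i \<cdot>\<^sub>v u)"
  using \<open>finite I\<close> A comm W
proof (induction I rule: finite_induct)
  case empty
  then show ?case using w by auto
next
  case (insert k I)
  then obtain u c where u: "u \<in> W" "u \<noteq> 0\<^sub>v n" "\<And>i. i \<in> I \<Longrightarrow> A i *\<^sub>v u = c i \<cdot>\<^sub>v u"
    by (metis insert_iff)
  define E where "E = {x \<in> W. \<forall>i\<in>I. A i *\<^sub>v x = c i \<cdot>\<^sub>v x}"
  have Wc: "x \<in> carrier_vec n" if "x \<in> W" for x
    using insert.prems(3) that by (auto simp: vec_subspace_def)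
  have E: "vec_subspace n E"
  proof -
    have "A i *\<^sub>v 0\<^sub>v n = c i \<cdot>\<^sub>v 0\<^sub>v n" if "i \<in> I" for i
      using insert.prems(1)[of i] that by auto
    moreover have "A i *\<^sub>v (x + y) = c i \<cdot>\<^sub>v (x + y)"
      if "i \<in> I" "x \<in> W" "y \<in> W" "A i *\<^sub>v x = c i \<cdot>\<^sub>v x" "A i *\<^sub>v y = c i \<cdot>\<^sub>v y" for i x y
      using insert.prems(1)[of i] that Wc
      by (simp add: mult_add_distrib_mat_vec[of _ n n] smult_add_distrib_vec[of _ n])
    moreover have "A i *\<^sub>v (a \<cdot>\<^sub>v x) = c i \<cdot>\<^sub>v (a \<cdot>\<^sub>v x)"
      if "i \<in> I" "x \<in> W" "A i *\<^sub>v x = c i \<cdot>\<^sub>v x" for i x a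
      using insert.prems(1)[of i] that Wc[of x]
      by (simp add: mult_mat_vec[of _ n n] smult_smult_assoc mult.commute)
    ultimately show ?thesis
      using insert.prems(3) unfolding vec_subspace_def E_def by auto
  qed
  have "A k *\<^sub>v x \<in> E" if x: "x \<in> E" for x
  proof -
    have xW: "x \<in> W" and ev: "\<And>i. i \<in> I \<Longrightarrow> A i *\<^sub>v x = c i \<cdot>\<^sub>v x" using x by (auto simp: E_def)
    have "A i *\<^sub>v (A k *\<^sub>v x) = c i \<cdot>\<^sub>v (A k *\<^sub>v x)" if i: "i \<in> I" for i
    proof -
      note Ai = insert.prems(1)[of i] and Ak = insert.prems(1)[of k]
      have "A i *\<^sub>v (A k *\<^sub>v x) = (A i * A k) *\<^sub>v x"
        using Ai Ak i Wc[OF xW] by simp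
      also have "\<dots> = (A k * A i) *\<^sub>v x" using insert.prems(2)[of i k] i by simp
      also have "\<dots> = A k *\<^sub>v (c i \<cdot>\<^sub>v x)" using Ai Ak i Wc[OF xW] ev[OF i] by simp
      also have "\<dots> = c i \<cdot>\<^sub>v (A k *\<^sub>v x)" using Ak Wc[OF xW] by (simp add: mult_mat_vec[of _ n n])
      finally show ?thesis .
    qed
    then show ?thesis using insert.prems(4)[of k x] xW by (simp add: E_def)
  qed
  moreover have "u \<in> E" using u by (simp add: E_def)
  ultimately obtain v d where "v \<in> E" "v \<noteq> 0\<^sub>v n" "A k *\<^sub>v v = d \<cdot>\<^sub>v v"
    using eigenvector_in_invariant_subspace[OF _ _ E, of "A k" u] insert.prems(1)[of k] u(2) Wc[OF u(1)]
    by auto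
  then have "v \<in> W" "v \<noteq> 0\<^sub>v n" "\<forall>i\<in>insert k I. A i *\<^sub>v v = (c(k := d)) i \<cdot>\<^sub>v v"
    using \<open>k \<notin> I\<close> by (auto simp: E_def)
  then show ?case by blast
qed

section \<open>Simultaneous unitary diagonalization\<close>

lemma eigenvalue_hermitian_real:
  assumes A: "A \<in> carrier_mat n n" "hermitian_mat A" and u: "u \<in> carrier_vec n" "u \<noteq> 0\<^sub>v n"
    and eq: "A *\<^sub>v u = c \<cdot>\<^sub>v u"
  shows "cnj c = c"
proof -
  have "c * (u \<bullet>c u) = (A *\<^sub>v u) \<bullet>c u" using u by (simp add: eq)
  also have "\<dots> = u \<bullet>c (A *\<^sub>v u)" using hermitian_cscalar_prod[OF A u(1) u(1)] .
  also have "\<dots> = cnj c * (u \<bullet>c u)" using u by (simp add: eq conjugate_smult_vec)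
  finally show ?thesis using u by simp
qed

text \<open>Fewer than $n$ linear conditions: as rows of a square matrix padded with zero rows they give a
  vanishing determinant, hence a nonzero kernel vector.\<close>
lemma orthogonal_complement_nontrivial:
  fixes u :: "nat \<Rightarrow> complex vec"
  assumes "k < n" and u: "\<And>j. j < k \<Longrightarrow> u j \<in> carrier_vec n"
  shows "\<exists>w\<in>carrier_vec n. w \<noteq> 0\<^sub>v n \<and> (\<forall>j<k. w \<bullet>c u j = 0)"
proof -
  define M where "M = mat n n (\<lambda>(i,j). if i < k then cnj (u i $ j) else 0)"
  have M: "M \<in> carrier_mat n n" by (simp add: M_def)
  have "det M = (\<Sum>j<n. M $$ (k,j) * cofactor M k j)"
    using laplace_expansion_row[OF M \<open>k < n\<close>] by simp
  also have "\<dots> = 0" using \<open>k < n\<close> by (intro sum.neutral) (auto simp: M_def)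
  finally obtain w where w: "w \<in> carrier_vec n" "w \<noteq> 0\<^sub>v n" "M *\<^sub>v w = 0\<^sub>v n"
    using det_0_iff_vec_prod_zero[OF M] by blast
  have "w \<bullet>c u j = 0" if j: "j < k" for j
  proof -
    have "w \<bullet>c u j = (M *\<^sub>v w) $ j"
      using w(1) u[OF j] j \<open>k < n\<close> by (simp add: M_def scalar_prod_def mult.commute)
    then show ?thesis using w(3) j \<open>k < n\<close> by simp
  qed
  with w show ?thesis by blast
qed

lemma elements_mat_subset_iff:
  assumes "A \<in> carrier_mat nr nc"
  shows "elements_mat A \<subseteq> K \<longleftrightarrow> (\<forall>i<nr. \<forall>j<nc. A $$ (i,j) \<in> K)"
  using assms by (auto dest!: elements_matD)

lemma conjugate_real_mat_mult_vec:
  assumes A: "A \<in> carrier_mat nr nc" "real_mat A" and x: "x \<in> carrier_vec nc"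
  shows "conjugate (A *\<^sub>v x) = A *\<^sub>v conjugate x"
  using assms
  by (intro eq_vecI) (auto simp: real_mat_def elements_mat_subset_iff[OF A(1)] scalar_prod_def
      intro!: sum.cong simp flip: Reals_cnj_iff)

text \<open>If the matrices are real and Hermitian then the eigenvalues are real, so $\bar u$ is a common
  eigenvector along with $u$. Then $u + \bar u$ is a real one, unless it vanishes; in that case $u$
  is purely imaginary and $\mathrm{i}\,u$ is a real one.\<close>
lemma common_eigenvector_real:
  fixes A :: "'i \<Rightarrow> complex mat"
  assumes A: "\<And>i. i \<in> I \<Longrightarrow> A i \<in> carrier_mat n n" "\<And>i. i \<in> I \<Longrightarrow> hermitian_mat (A i)"
      "\<And>i. i \<in> I \<Longrightarrow> real_mat (A i)"
    and W: "vec_subspace n W" "\<And>x. x \<in> W \<Longrightarrow> conjugate x \<in> W"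
    and u: "u \<in> W" "u \<noteq> 0\<^sub>v n" "\<And>i. i \<in> I \<Longrightarrow> A i *\<^sub>v u = c i \<cdot>\<^sub>v u"
  shows "\<exists>v\<in>W. v \<noteq> 0\<^sub>v n \<and> conjugate v = v \<and> (\<forall>i\<in>I. A i *\<^sub>v v = c i \<cdot>\<^sub>v v)"
proof -
  have uc: "u \<in> carrier_vec n" using u(1) W(1) by (auto simp: vec_subspace_def)
  have ev: "A i *\<^sub>v conjugate u = c i \<cdot>\<^sub>v conjugate u" if i: "i \<in> I" for i
  proof -
    have "A i *\<^sub>v conjugate u = conjugate (c i \<cdot>\<^sub>v u)"
      using conjugate_real_mat_mult_vec[OF A(1,3) uc] i u(3) by simp
    also have "\<dots> = c i \<cdot>\<^sub>v conjugate u"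
      using eigenvalue_hermitian_real[OF A(1,2) uc u(2,3)] i by (simp add: conjugate_smult_vec)
    finally show ?thesis .
  qed
  show ?thesis
  proof (cases "u + conjugate u = 0\<^sub>v n")
    case False
    have "A i *\<^sub>v (u + conjugate u) = c i \<cdot>\<^sub>v (u + conjugate u)" if "i \<in> I" for i
      using A(1)[OF that] uc u(3)[OF that] ev[OF that]
      by (simp add: mult_add_distrib_mat_vec[of _ n n] smult_add_distrib_vec[of _ n])
    moreover have "conjugate (u + conjugate u) = u + conjugate u"
      using uc by (intro eq_vecI) auto
    ultimately show ?thesis using False W u(1) by (metis vec_subspace_def)
  next
    case True
    have *: "conjugate u $ j = - (u $ j)" if "j < n" for j
      using arg_cong[OF True, of "\<lambda>v. v $ j"] that uc by (simp add: add_eq_0_iff)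
    have "A i *\<^sub>v (\<i> \<cdot>\<^sub>v u) = c i \<cdot>\<^sub>v (\<i> \<cdot>\<^sub>v u)" if "i \<in> I" for i
      using A(1)[OF that] uc u(3)[OF that]
      by (simp add: mult_mat_vec[of _ n n] smult_smult_assoc mult.commute)
    moreover have "conjugate (\<i> \<cdot>\<^sub>v u) = \<i> \<cdot>\<^sub>v u"
      using uc * by (intro eq_vecI) auto
    moreover have "\<i> \<cdot>\<^sub>v u \<noteq> 0\<^sub>v n" using u(2) uc by (simp add: smult_vec_eq_0_iff)
    moreover have "\<i> \<cdot>\<^sub>v u \<in> W" using W u(1) by (auto simp: vec_subspace_def)
    ultimately show ?thesis by blast
  qed
qed

text \<open>An orthonormal system of $k < n$ common eigenvectors extends by one: its orthogonal complement
  is nonzero and, the matrices being Hermitian, invariant, so it contains a further common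
  eigenvector. When the system is real, the complement is closed under conjugation and the new
  vector can be taken real. The set $K$ of scalars carries the real and the complex case through
  one argument.\<close>
lemma orthonormal_common_eigenvectors:
  fixes A :: "'i \<Rightarrow> complex mat"
  assumes K: "K = \<real> \<or> K = UNIV" and "finite I"
    and A: "\<And>i. i \<in> I \<Longrightarrow> A i \<in> carrier_mat n n" "\<And>i. i \<in> I \<Longrightarrow> hermitian_mat (A i)"
      "\<And>i. i \<in> I \<Longrightarrow> elements_mat (A i) \<subseteq> K"
    and comm: "\<And>i j. i \<in> I \<Longrightarrow> j \<in> I \<Longrightarrow> A i * A j = A j * A i"
    and "k \<le> n"
  shows "\<exists>u. (\<forall>j<k. u j \<in> carrier_vec n \<and> (\<forall>l<n. u j $ l \<in> K) \<and>
                 (\<forall>i\<in>I. \<exists>c. A i *\<^sub>v u j = c \<cdot>\<^sub>v u j)) \<and>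
             (\<forall>j<k. \<forall>l<k. u j \<bullet>c u l = (if j = l then 1 else 0))"
  using \<open>k \<le> n\<close>
proof (induction k)
  case 0
  then show ?case by simp
next
  case (Suc k)
  then have "k \<le> n" by simp
  from Suc.IH[OF this] obtain u where u: "\<And>j. j < k \<Longrightarrow> u j \<in> carrier_vec n"
      "\<And>j l. j < k \<Longrightarrow> l < n \<Longrightarrow> u j $ l \<in> K"
      "\<And>j i. j < k \<Longrightarrow> i \<in> I \<Longrightarrow> \<exists>c. A i *\<^sub>v u j = c \<cdot>\<^sub>v u j"
      "\<And>j l. j < k \<Longrightarrow> l < k \<Longrightarrow> u j \<bullet>c u l = (if j = l then 1 else 0)"
    by blast
  define W where "W = {x \<in> carrier_vec n. \<forall>j<k. x \<bullet>c u j = 0}"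
  have W: "vec_subspace n W"
    using u(1) unfolding vec_subspace_def W_def
    by (auto simp: add_scalar_prod_distrib[of _ n])
  have inv: "A i *\<^sub>v x \<in> W" if "i \<in> I" "x \<in> W" for i x
  proof -
    have "(A i *\<^sub>v x) \<bullet>c u j = 0" if j: "j < k" for j
    proof -
      obtain c where c: "A i *\<^sub>v u j = c \<cdot>\<^sub>v u j" using u(3) j \<open>i \<in> I\<close> by blast
      have "(A i *\<^sub>v x) \<bullet>c u j = x \<bullet>c (A i *\<^sub>v u j)"
        using hermitian_cscalar_prod[OF A(1,2), OF \<open>i \<in> I\<close> \<open>i \<in> I\<close> _ u(1)[OF j]] \<open>x \<in> W\<close>
        by (simp add: W_def)
      then show ?thesis using \<open>x \<in> W\<close> u(1)[OF j] j
        by (auto simp: c conjugate_smult_vec W_def)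
    qed
    then show ?thesis using A(1)[OF \<open>i \<in> I\<close>] \<open>x \<in> W\<close> by (auto simp: W_def)
  qed
  have "\<exists>v\<in>W. v \<noteq> 0\<^sub>v n \<and> (\<forall>l<n. v $ l \<in> K) \<and> (\<exists>c. \<forall>i\<in>I. A i *\<^sub>v v = c i \<cdot>\<^sub>v v)"
  proof -
    obtain w where "w \<in> W" "w \<noteq> 0\<^sub>v n"
      using orthogonal_complement_nontrivial[of k n u] Suc.prems u(1) by (auto simp: W_def)
    then obtain v c where v: "v \<in> W" "v \<noteq> 0\<^sub>v n" "\<And>i. i \<in> I \<Longrightarrow> A i *\<^sub>v v = c i \<cdot>\<^sub>v v"
      using common_eigenvector_in_invariant_subspace[where A = A and w = w, OF \<open>finite I\<close> A(1) comm W inv]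
      by blast
    from K show ?thesis
    proof
      assume "K = UNIV"
      with v show ?thesis by auto
    next
      assume K: "K = \<real>"
      have "conjugate x \<in> W" if x: "x \<in> W" for x
      proof -
        have "conjugate x \<bullet>c u j = 0" if j: "j < k" for j
        proof -
          have uj: "conjugate (u j) = u j"
            using u(1,2)[OF j] by (intro eq_vecI) (auto simp: K Reals_cnj_iff)
          have "conjugate x \<bullet>c u j = conjugate (x \<bullet>c u j)"
            using x u(1)[OF j] by (subst conjugate_sprod_vec[of _ n]) (auto simp: W_def uj)
          then show ?thesis using x j by (simp add: W_def)
        qed
        then show ?thesis using x by (auto simp: W_def)
      qed
      note conj = this
      have "\<exists>x\<in>W. x \<noteq> 0\<^sub>v n \<and> conjugate x = x \<and> (\<forall>i\<in>I. A i *\<^sub>v x = c i \<cdot>\<^sub>v x)"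
        by (rule common_eigenvector_real[where A = A and u = v])
          (use A(3) in \<open>simp_all add: A(1,2) W v conj K real_mat_def\<close>)
      then obtain x where x: "x \<in> W" "x \<noteq> 0\<^sub>v n" "conjugate x = x"
          "\<forall>i\<in>I. A i *\<^sub>v x = c i \<cdot>\<^sub>v x"
        by blast
      have "x $ l \<in> K" if "l < n" for l
        using vec_index_conjugate[of l x] x(3) that x(1) by (auto simp: W_def K Reals_cnj_iff)
      with x show ?thesis by blast
    qed
  qed
  then obtain v c where v: "v \<in> W" "v \<noteq> 0\<^sub>v n" "\<And>l. l < n \<Longrightarrow> v $ l \<in> K"
      "\<And>i. i \<in> I \<Longrightarrow> A i *\<^sub>v v = c i \<cdot>\<^sub>v v" by blast
  have vc: "v \<in> carrier_vec n" and vu: "\<And>j. j < k \<Longrightarrow> v \<bullet>c u j = 0" using v(1) by (auto simp: W_def)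
  have pos: "0 < v \<bullet>c v" using v(2) vc by simp
  define r where "r = Re (v \<bullet>c v)"
  have r: "v \<bullet>c v = of_real r" "r > 0" using pos by (auto simp: r_def less_complex_def complex_eq_iff)
  define a where "a = complex_of_real (1 / sqrt r)"
  have a: "cnj a = a" "a * a * of_real r = 1"
    using r(2) unfolding a_def by (simp_all flip: of_real_mult add: field_simps)
  define x where "x = a \<cdot>\<^sub>v v"
  have xc: "x \<in> carrier_vec n" using vc by (simp add: x_def)
  have "x \<bullet>c x = 1" using vc a by (simp add: x_def conjugate_smult_vec r(1) mult_ac)
  moreover have xu: "x \<bullet>c u j = 0" if "j < k" for j
    using vc u(1)[OF that] vu[OF that] by (simp add: x_def)
  moreover have "u j \<bullet>c x = 0" if "j < k" for j
  proof -
    have "u j \<bullet>c x = conjugate (x \<bullet>c u j)"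
      using xc u(1)[OF that] by (subst conjugate_sprod_vec[of _ n]) (auto simp: comm_scalar_prod[of _ n])
    then show ?thesis using xu[OF that] by simp
  qed
  moreover have "x $ l \<in> K" if "l < n" for l
    using K v(3)[OF that] vc that by (auto simp: x_def a_def)
  moreover have "A i *\<^sub>v x = c i \<cdot>\<^sub>v x" if "i \<in> I" for i
    using A(1)[OF that] vc v(4)[OF that]
    by (simp add: x_def mult_mat_vec[of _ n n] smult_smult_assoc mult.commute)
  ultimately show ?case using u xc
    by (intro exI[of _ "u(k := x)"]) (auto simp: less_Suc_eq)
qed

text \<open>The spectral theorem for a finite commuting family; a single matrix is the case of a singleton $I$.\<close>
lemma simultaneous_unitary_diagonalization:
  fixes A :: "'i \<Rightarrow> complex mat"
  assumes K: "K = \<real> \<or> K = UNIV" and "finite I"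
    and A: "\<And>i. i \<in> I \<Longrightarrow> A i \<in> carrier_mat n n" "\<And>i. i \<in> I \<Longrightarrow> hermitian_mat (A i)"
      "\<And>i. i \<in> I \<Longrightarrow> elements_mat (A i) \<subseteq> K"
    and comm: "\<And>i j. i \<in> I \<Longrightarrow> j \<in> I \<Longrightarrow> A i * A j = A j * A i"
  shows "\<exists>U\<in>carrier_mat n n. elements_mat U \<subseteq> K \<and> mat_adjoint U * U = 1\<^sub>m n \<and>
           U * mat_adjoint U = 1\<^sub>m n \<and> (\<forall>i\<in>I. diagonal_mat (mat_adjoint U * A i * U))"
proof -
  obtain u where u: "\<And>j. j < n \<Longrightarrow> u j \<in> carrier_vec n"
      "\<And>j l. j < n \<Longrightarrow> l < n \<Longrightarrow> u j $ l \<in> K"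
      "\<And>j i. j < n \<Longrightarrow> i \<in> I \<Longrightarrow> \<exists>c. A i *\<^sub>v u j = c \<cdot>\<^sub>v u j"
      "\<And>j l. j < n \<Longrightarrow> l < n \<Longrightarrow> u j \<bullet>c u l = (if j = l then 1 else 0)"
    using orthonormal_common_eigenvectors[where A = A and k = n, OF K \<open>finite I\<close> A comm order_refl] by blast
  define U where "U = mat n n (\<lambda>(i,j). u j $ i)"
  have U: "U \<in> carrier_mat n n" by (simp add: U_def)
  note U' = mat_adjoint_carrier[OF U]
  have colU: "col U j = u j" if "j < n" for j
    using that u(1)[OF that] by (intro eq_vecI) (auto simp: U_def)
  have rowU: "row (mat_adjoint U) j = conjugate (u j)" if "j < n" for j
    using that u(1)[OF that] U' mat_adjoint_index[OF U that]
    by (intro eq_vecI) (auto simp: U_def)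
  have prod: "(mat_adjoint U * B) $$ (j,l) = col B l \<bullet>c u j"
    if "B \<in> carrier_mat n n" "j < n" "l < n" for B j l
    using that U' u(1)[OF that(2)]
    by (auto simp: rowU intro!: comm_scalar_prod[of _ n])
  have UU: "mat_adjoint U * U = 1\<^sub>m n"
    using U U' by (intro eq_matI) (auto simp: prod colU u(4) simp del: index_mult_mat(1))
  moreover have "U * mat_adjoint U = 1\<^sub>m n"
    using mat_mult_left_right_inverse[OF U' U UU] .
  moreover have "elements_mat U \<subseteq> K"
    unfolding elements_mat_subset_iff[OF U] using u(2) by (auto simp: U_def)
  moreover have "diagonal_mat (mat_adjoint U * A i * U)" if i: "i \<in> I" for i
  proof -
    have "(mat_adjoint U * (A i * U)) $$ (j,l) = 0" if jl: "j < n" "l < n" "j \<noteq> l" for j l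
    proof -
      obtain c where c: "A i *\<^sub>v u l = c \<cdot>\<^sub>v u l" using u(3) jl i by blast
      have "col (A i * U) l = A i *\<^sub>v u l"
        unfolding col_mult2[OF A(1)[OF i] U jl(2)] colU[OF jl(2)] ..
      then have "(mat_adjoint U * (A i * U)) $$ (j,l) = (c \<cdot>\<^sub>v u l) \<bullet>c u j"
        using prod[of "A i * U" j l] A(1)[OF i] U jl c by simp
      also have "\<dots> = 0" using u(1)[of l] u(1)[of j] u(4)[of l j] jl by simp
      finally show ?thesis .
    qed
    then show ?thesis using A(1)[OF i] U U'
      by (auto simp: diagonal_mat_def assoc_mult_mat[of _ n n _ n _ n] simp del: index_mult_mat(1))
  qed
  ultimately show ?thesis using U by blast
qed

section \<open>Invertible and positive definite matrices\<close>

lemma elements_mult_subset: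
  assumes K: "K = \<real> \<or> K = UNIV" and "A \<in> carrier_mat n n" "B \<in> carrier_mat n n"
    "elements_mat A \<subseteq> K" "elements_mat (B :: complex mat) \<subseteq> K"
  shows "elements_mat (A * B) \<subseteq> K"
  using assms(2-) K elements_mat_subset_iff[of "A * B" n n K]
  by (auto simp: elements_mat_subset_iff[of _ n n] scalar_prod_def intro!: sum_in_Reals)

lemma elements_adjoint_subset:
  assumes K: "K = \<real> \<or> K = UNIV" and A: "A \<in> carrier_mat n n" "elements_mat (A :: complex mat) \<subseteq> K"
  shows "elements_mat (mat_adjoint A) \<subseteq> K"
  using A(2) K unfolding elements_mat_subset_iff[OF A(1)] elements_mat_subset_iff[OF mat_adjoint_carrier[OF A(1)]]
  by (auto simp: mat_adjoint_index[OF A(1)])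

lemma invertible_matD:
  assumes "invertible_mat P" "P \<in> carrier_mat n n"
  obtains B where "B \<in> carrier_mat n n" "P * B = 1\<^sub>m n" "B * P = 1\<^sub>m n"
proof -
  obtain B where B: "P * B = 1\<^sub>m n" "B * P = 1\<^sub>m (dim_row B)"
    using assms unfolding invertible_mat_def inverts_mat_def by auto
  have "dim_col B = n" using arg_cong[OF B(1), of dim_col] by simp
  moreover have "dim_row B = n" using arg_cong[OF B(2), of dim_col] assms(2) by simp
  ultimately show ?thesis using B that[of B] by auto
qed

lemma invertible_matI:
  assumes "P \<in> carrier_mat n n" "B \<in> carrier_mat n n" "P * B = 1\<^sub>m n" "B * P = 1\<^sub>m n"
  shows "invertible_mat P"
  using assms unfolding invertible_mat_def inverts_mat_def by auto

lemma invertible_mat_mult: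
  fixes P Q :: "complex mat"
  assumes P: "P \<in> carrier_mat n n" "invertible_mat P" and Q: "Q \<in> carrier_mat n n" "invertible_mat Q"
  shows "invertible_mat (P * Q)"
proof -
  obtain B where B: "B \<in> carrier_mat n n" "P * B = 1\<^sub>m n" "B * P = 1\<^sub>m n"
    using invertible_matD P by blast
  obtain C where C: "C \<in> carrier_mat n n" "Q * C = 1\<^sub>m n" "C * Q = 1\<^sub>m n"
    using invertible_matD Q by blast
  have "P * Q * (C * B) = P * (Q * C) * B" "C * B * (P * Q) = C * (B * P) * Q"
    using P Q B(1) C(1) by (simp_all add: assoc_mult_mat[of _ n n _ n _ n])
  then show ?thesis
    using P Q B C by (intro invertible_matI[of _ n "C * B"]) auto
qed

lemma invertible_mat_adjoint:
  assumes P: "P \<in> carrier_mat n n" "invertible_mat (P :: complex mat)"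
  shows "invertible_mat (mat_adjoint P)"
proof -
  obtain B where B: "B \<in> carrier_mat n n" "P * B = 1\<^sub>m n" "B * P = 1\<^sub>m n"
    using invertible_matD P by blast
  have "mat_adjoint P * mat_adjoint B = 1\<^sub>m n" "mat_adjoint B * mat_adjoint P = 1\<^sub>m n"
    using mat_adjoint_mult[OF B(1) P(1), symmetric] mat_adjoint_mult[OF P(1) B(1), symmetric]
    by (simp_all add: B(2,3) mat_adjoint_one)
  then show ?thesis
    using mat_adjoint_carrier[OF P(1)] mat_adjoint_carrier[OF B(1)] by (intro invertible_matI)
qed

lemma positive_definite_mult_adjoint:
  assumes P: "P \<in> carrier_mat n n" "invertible_mat P"
  shows "positive_definite_mat n (P * mat_adjoint P)"
  unfolding positive_definite_mat_def
proof (intro conjI ballI impI)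
  note P' = mat_adjoint_carrier[OF P(1)]
  show "P * mat_adjoint P \<in> carrier_mat n n" using P(1) P' by simp
  show "hermitian_mat (P * mat_adjoint P)"
    unfolding hermitian_mat_def mat_adjoint_mult[OF P(1) P'] mat_adjoint_adjoint ..
  fix v :: "complex vec" assume v: "v \<in> carrier_vec n" "v \<noteq> 0\<^sub>v n"
  define w where "w = mat_adjoint P *\<^sub>v v"
  have w: "w \<in> carrier_vec n" using P' v by (simp add: w_def)
  obtain B where B: "B \<in> carrier_mat n n" "B * mat_adjoint P = 1\<^sub>m n"
    using invertible_matD[OF invertible_mat_adjoint[OF P] P'] by blast
  have "B *\<^sub>v w = (B * mat_adjoint P) *\<^sub>v v" using B(1) P' v by (simp add: w_def)
  then have "B *\<^sub>v w = v" using v(1) by (simp add: B(2))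
  moreover have "B *\<^sub>v 0\<^sub>v n = 0\<^sub>v n" using B(1) by auto
  ultimately have "w \<noteq> 0\<^sub>v n" using v(2) by auto
  then have "0 < w \<bullet>c w" using w by simp
  also have "w \<bullet>c w = (P *\<^sub>v w) \<bullet>c v"
    using cscalar_prod_adjoint[OF P(1) w v(1)] by (simp add: w_def)
  also have "P *\<^sub>v w = (P * mat_adjoint P) *\<^sub>v v" using P P' v by (simp add: w_def)
  finally show "0 < ((P * mat_adjoint P) *\<^sub>v v) \<bullet>c v" .
qed

lemma positive_definite_invertible:
  assumes "positive_definite_mat n Q"
  shows "invertible_mat Q"
proof -
  have Q: "Q \<in> carrier_mat n n" using assms by (simp add: positive_definite_mat_def)
  have "det Q \<noteq> 0"
  proof
    assume "det Q = 0"
    then obtain v where v: "v \<in> carrier_vec n" "v \<noteq> 0\<^sub>v n" "Q *\<^sub>v v = 0\<^sub>v n"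
      using det_0_iff_vec_prod_zero[OF Q] by blast
    then have "0 < (0\<^sub>v n :: complex vec) \<bullet>c v"
      using assms unfolding positive_definite_mat_def by metis
    then show False using v(1) by simp
  qed
  from det_non_zero_imp_unit[OF Q this] obtain B where "B \<in> carrier_mat n n" "B * Q = 1\<^sub>m n" "Q * B = 1\<^sub>m n"
    unfolding Units_def by (auto simp: ring_mat_def)
  then show ?thesis using Q by (intro invertible_matI)
qed

lemma mat_diag_adjoint_real:
  assumes "\<And>i. i < n \<Longrightarrow> e i \<in> \<real>"
  shows "mat_adjoint (mat_diag n e) = mat_diag n (e :: nat \<Rightarrow> complex)"
proof (rule eq_matI)
  fix i j assume "i < dim_row (mat_diag n e)" "j < dim_col (mat_diag n e)"
  then have ij: "i < n" "j < n" by (simp_all add: mat_diag_def)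
  show "mat_adjoint (mat_diag n e) $$ (i,j) = mat_diag n e $$ (i,j)"
    unfolding mat_adjoint_index[OF mat_diag_dim ij]
    using ij assms by (simp add: mat_diag_def Reals_cnj_iff)
qed (use mat_adjoint_carrier[OF mat_diag_dim[of n e]] in \<open>auto simp: mat_diag_def\<close>)

lemma diagonal_mat_eq_mat_diag:
  assumes "D \<in> carrier_mat n n" "diagonal_mat D"
  shows "D = mat_diag n (\<lambda>i. D $$ (i,i))"
  using assms by (intro eq_matI) (auto simp: mat_diag_def diagonal_mat_def)

lemma diagonal_mat_commute:
  fixes D E :: "complex mat"
  assumes "D \<in> carrier_mat n n" "diagonal_mat D" "E \<in> carrier_mat n n" "diagonal_mat E"
  shows "D * E = E * D"
proof -
  obtain d e where "D = mat_diag n d" "E = mat_diag n e"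
    using diagonal_mat_eq_mat_diag assms by blast
  then show ?thesis by (simp add: mult.commute)
qed

text \<open>With $X = U D U^*$ unitarily diagonalized, the root is $U D^{1/2} U^*$. Its positive definiteness
  is obtained by writing it as $R R^*$ for the invertible matrix $R = U D^{1/4}$.\<close>
lemma positive_definite_sqrt:
  assumes K: "K = \<real> \<or> K = UNIV" and X: "positive_definite_mat n X" "elements_mat X \<subseteq> K"
  shows "\<exists>Q. positive_definite_mat n Q \<and> elements_mat Q \<subseteq> K \<and> Q * Q = X"
proof -
  have Xc: "X \<in> carrier_mat n n" and Xh: "hermitian_mat X"
    and Xp: "\<And>v. v \<in> carrier_vec n \<Longrightarrow> v \<noteq> 0\<^sub>v n \<Longrightarrow> 0 < (X *\<^sub>v v) \<bullet>c v"
    using X(1) by (auto simp: positive_definite_mat_def)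
  obtain U where U: "U \<in> carrier_mat n n" "elements_mat U \<subseteq> K" "mat_adjoint U * U = 1\<^sub>m n"
      "U * mat_adjoint U = 1\<^sub>m n" "diagonal_mat (mat_adjoint U * X * U)"
    using simultaneous_unitary_diagonalization[OF K, of "{()}" "\<lambda>_. X" n] Xc Xh X(2) by auto
  note U' = mat_adjoint_carrier[OF U(1)]
  define d where "d i = (mat_adjoint U * X * U) $$ (i,i)" for i
  have D: "mat_adjoint U * X * U = mat_diag n d"
    unfolding d_def using U(1) U' Xc by (intro diagonal_mat_eq_mat_diag U(5)) simp
  \<comment> \<open>The diagonal entry is the value of the form of $X$ at the $i$-th column of $U$.\<close>
  have d: "d i > 0" if i: "i < n" for i
  proof -
    have e: "unit_vec n i \<in> carrier_vec n" "U *\<^sub>v unit_vec n i \<noteq> 0\<^sub>v n"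
    proof -
      have "(mat_adjoint U * U) *\<^sub>v unit_vec n i = unit_vec n i" by (simp add: U(3))
      then have "mat_adjoint U *\<^sub>v (U *\<^sub>v unit_vec n i) = unit_vec n i"
        using U(1) U' by simp
      moreover have "mat_adjoint U *\<^sub>v 0\<^sub>v n = 0\<^sub>v n" using U' by auto
      ultimately show "U *\<^sub>v unit_vec n i \<noteq> 0\<^sub>v n" using unit_vec_nonzero[OF i] by metis
    qed simp
    have "0 < (X *\<^sub>v (U *\<^sub>v unit_vec n i)) \<bullet>c (U *\<^sub>v unit_vec n i)"
      using Xp[of "U *\<^sub>v unit_vec n i"] e U(1) by auto
    also have "\<dots> = (mat_adjoint U *\<^sub>v (X *\<^sub>v (U *\<^sub>v unit_vec n i))) \<bullet>c unit_vec n i"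
      using cscalar_prod_adjoint[OF U', of "X *\<^sub>v (U *\<^sub>v unit_vec n i)" "unit_vec n i"] Xc U(1)
      by (simp add: mat_adjoint_adjoint)
    also have "mat_adjoint U *\<^sub>v (X *\<^sub>v (U *\<^sub>v unit_vec n i)) = mat_diag n d *\<^sub>v unit_vec n i"
      unfolding D[symmetric] using Xc U(1) U' by (simp add: assoc_mult_mat_vec[of _ n n _ n])
    also have "\<dots> \<bullet>c unit_vec n i = d i"
    proof -
      have "conjugate (unit_vec n i :: complex vec) = unit_vec n i"
        by (intro eq_vecI) (auto simp: unit_vec_def)
      then show ?thesis using i by (simp add: mat_diag_def)
    qed
    finally show ?thesis .
  qed
  \<comment> \<open>The fourth root, so that $R = U E$ satisfies $R R^* = U D^{1/2} U^*$.\<close>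
  define e where "e i = complex_of_real (sqrt (sqrt (Re (d i))))" for i
  have e4: "(e i * e i) * (e i * e i) = d i" "e i \<noteq> 0" if "i < n" for i
    using d[OF that] by (simp_all add: e_def complex_eq_iff less_complex_def flip: of_real_mult)
  define E where "E = mat_diag n e"
  have E: "E \<in> carrier_mat n n" "mat_adjoint E = E"
    by (simp_all add: E_def mat_diag_adjoint_real e_def)
  have E4: "(E * E) * (E * E) = mat_diag n d"
    unfolding E_def mat_diag_diag by (intro eq_matI) (auto simp: mat_diag_def e4)
  have "E * mat_diag n (\<lambda>i. inverse (e i)) = 1\<^sub>m n" "mat_diag n (\<lambda>i. inverse (e i)) * E = 1\<^sub>m n"
    unfolding E_def mat_diag_diag using e4(2) by (auto simp: mat_diag_def intro!: eq_matI)
  then have "invertible_mat E" using E(1) by (intro invertible_matI[OF _ mat_diag_dim])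
  define R where "R = U * E"
  have R: "R \<in> carrier_mat n n" "mat_adjoint R = E * mat_adjoint U"
    using U(1) E by (simp_all add: R_def mat_adjoint_mult[of _ n n _ n])
  have "invertible_mat R"
    unfolding R_def using U U' E(1) \<open>invertible_mat E\<close>
    by (intro invertible_mat_mult[of _ n] invertible_matI[of U n "mat_adjoint U"])
  define Q where "Q = R * mat_adjoint R"
  have "positive_definite_mat n Q"
    unfolding Q_def using R(1) \<open>invertible_mat R\<close> by (rule positive_definite_mult_adjoint)
  moreover have "elements_mat Q \<subseteq> K"
  proof -
    have "elements_mat E \<subseteq> K"
      using K unfolding elements_mat_subset_iff[OF E(1)] by (auto simp: E_def mat_diag_def e_def)
    then have RK: "elements_mat R \<subseteq> K"
      unfolding R_def using U(1,2) E(1) by (intro elements_mult_subset[OF K])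
    show ?thesis
      unfolding Q_def using RK R(1) mat_adjoint_carrier[OF R(1)] elements_adjoint_subset[OF K R(1) RK]
      by (intro elements_mult_subset[OF K])
  qed
  moreover have "Q * Q = X"
  proof -
    have "Q = U * E * (E * mat_adjoint U)" unfolding Q_def R(2) by (simp only: R_def)
    then have "Q * Q = U * E * E * (mat_adjoint U * U) * E * E * mat_adjoint U"
      using U(1) U' E(1) by (simp add: assoc_mult_mat[of _ n n _ n _ n])
    also have "\<dots> = U * ((E * E) * (E * E)) * mat_adjoint U"
      unfolding U(3) using U(1) U' E(1) by (simp add: assoc_mult_mat[of _ n n _ n _ n])
    also have "\<dots> = (U * mat_adjoint U) * X * (U * mat_adjoint U)"
      unfolding E4 D[symmetric] using U(1) U' Xc by (simp add: assoc_mult_mat[of _ n n _ n _ n])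
    also have "\<dots> = X" unfolding U(4) using Xc by simp
    finally show ?thesis .
  qed
  ultimately show ?thesis by blast
qed

section \<open>The four conditions over a fixed set of scalars\<close>

text \<open>The product $(P^* A P)(P^* B P)$ equals $P^* (A X B) P$ with $X = P P^*$, and the outer factors
  cancel.\<close>
lemma commuting_congruences_imp_linear_equation:
  fixes A B P :: "complex mat"
  assumes P: "P \<in> carrier_mat n n" "invertible_mat P"
    and A: "A \<in> carrier_mat n n" and B: "B \<in> carrier_mat n n"
    and comm: "(mat_adjoint P * A * P) * (mat_adjoint P * B * P) =
               (mat_adjoint P * B * P) * (mat_adjoint P * A * P)"
  shows "A * (P * mat_adjoint P) * B = B * (P * mat_adjoint P) * A"
proof -
  note P' = mat_adjoint_carrier[OF P(1)]
  obtain R where R: "R \<in> carrier_mat n n" "P * R = 1\<^sub>m n"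
    using invertible_matD[OF P(2,1)] by blast
  obtain L where L: "L \<in> carrier_mat n n" "L * mat_adjoint P = 1\<^sub>m n"
    using invertible_matD[OF invertible_mat_adjoint[OF P] P'] by blast
  have cancel: "L * ((mat_adjoint P * F * P) * (mat_adjoint P * G * P)) * R = F * (P * mat_adjoint P) * G"
    if F: "F \<in> carrier_mat n n" and G: "G \<in> carrier_mat n n" for F G
  proof -
    have "L * ((mat_adjoint P * F * P) * (mat_adjoint P * G * P)) * R
        = (L * mat_adjoint P) * (F * (P * mat_adjoint P) * G) * (P * R)"
      using P(1) P' R(1) L(1) F G by (simp add: assoc_mult_mat[of _ n n _ n _ n])
    also have "\<dots> = F * (P * mat_adjoint P) * G"
      unfolding R(2) L(2) using P(1) P' F G by simp
    finally show ?thesis .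
  qed
  show ?thesis using cancel[OF A B] cancel[OF B A] comm by simp
qed

lemma linear_equation_imp_commuting_congruences:
  fixes A B Q :: "complex mat"
  assumes Q: "Q \<in> carrier_mat n n" and A: "A \<in> carrier_mat n n" and B: "B \<in> carrier_mat n n"
    and eq: "A * (Q * Q) * B = B * (Q * Q) * A"
  shows "(Q * A * Q) * (Q * B * Q) = (Q * B * Q) * (Q * A * Q)"
proof -
  have "(Q * F * Q) * (Q * G * Q) = Q * (F * (Q * Q) * G) * Q"
    if "F \<in> carrier_mat n n" "G \<in> carrier_mat n n" for F G
    using Q that by (simp add: assoc_mult_mat[of _ n n _ n _ n])
  then show ?thesis using A B eq by simp
qed

lemma SDC_imp_commuting_congruences:
  fixes C :: "nat \<Rightarrow> complex mat"
  assumes C: "\<And>i. i \<in> {1..m} \<Longrightarrow> C i \<in> carrier_mat n n"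
    and P: "diagonalizing_congruence n m C P"
  shows "pairwise_commute m (\<lambda>i. mat_adjoint P * C i * P)"
  unfolding pairwise_commute_def
proof (intro ballI)
  have Pc: "P \<in> carrier_mat n n" using P by (simp add: diagonalizing_congruence_def)
  have *: "mat_adjoint P * C i * P \<in> carrier_mat n n" "diagonal_mat (mat_adjoint P * C i * P)"
    if "i \<in> {1..m}" for i
  proof -
    show "mat_adjoint P * C i * P \<in> carrier_mat n n"
      using Pc mat_adjoint_carrier[OF Pc] C[OF that] by simp
    show "diagonal_mat (mat_adjoint P * C i * P)"
      using P that unfolding diagonalizing_congruence_def by blast
  qed
  fix i j assume "i \<in> {1..m}" "j \<in> {1..m}"
  then show "mat_adjoint P * C i * P * (mat_adjoint P * C j * P) =
      mat_adjoint P * C j * P * (mat_adjoint P * C i * P)"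
    using * by (intro diagonal_mat_commute)
qed

lemma commuting_congruences_imp_positive_definite_solution:
  fixes C :: "nat \<Rightarrow> complex mat"
  assumes K: "K = \<real> \<or> K = UNIV"
    and C: "\<And>i. i \<in> {1..m} \<Longrightarrow> C i \<in> carrier_mat n n"
    and P: "P \<in> carrier_mat n n" "elements_mat P \<subseteq> K" "invertible_mat P"
    and comm: "pairwise_commute m (\<lambda>i. mat_adjoint P * C i * P)"
  shows "\<exists>X. elements_mat X \<subseteq> K \<and> positive_definite_mat n X \<and>
           (\<forall>i j. 1 \<le> i \<and> i < j \<and> j \<le> m \<longrightarrow> C i * X * C j = C j * X * C i)"
proof (intro exI conjI allI impI)
  show "elements_mat (P * mat_adjoint P) \<subseteq> K"
    using elements_mult_subset[OF K P(1) mat_adjoint_carrier[OF P(1)] P(2) elements_adjoint_subset[OF K P(1,2)]] .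
  show "positive_definite_mat n (P * mat_adjoint P)"
    using P(1,3) by (rule positive_definite_mult_adjoint)
  fix i j assume "1 \<le> i \<and> i < j \<and> j \<le> m"
  then have "i \<in> {1..m}" "j \<in> {1..m}" by auto
  then show "C i * (P * mat_adjoint P) * C j = C j * (P * mat_adjoint P) * C i"
    using comm C unfolding pairwise_commute_def
    by (intro commuting_congruences_imp_linear_equation[OF P(1,3)]) blast+
qed

lemma positive_definite_solution_imp_commuting_congruences:
  fixes C :: "nat \<Rightarrow> complex mat"
  assumes K: "K = \<real> \<or> K = UNIV"
    and C: "\<And>i. i \<in> {1..m} \<Longrightarrow> C i \<in> carrier_mat n n"
    and X: "elements_mat X \<subseteq> K" "positive_definite_mat n X"
    and eq: "\<And>i j. 1 \<le> i \<Longrightarrow> i < j \<Longrightarrow> j \<le> m \<Longrightarrow> C i * X * C j = C j * X * C i"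
  shows "\<exists>Q. elements_mat Q \<subseteq> K \<and> positive_definite_mat n Q \<and> pairwise_commute m (\<lambda>i. Q * C i * Q)"
proof -
  obtain Q where Q: "positive_definite_mat n Q" "elements_mat Q \<subseteq> K" "Q * Q = X"
    using positive_definite_sqrt[OF K X(2,1)] by blast
  have Qc: "Q \<in> carrier_mat n n" using Q(1) by (simp add: positive_definite_mat_def)
  have "(Q * C i * Q) * (Q * C j * Q) = (Q * C j * Q) * (Q * C i * Q)"
    if i: "i \<in> {1..m}" and j: "j \<in> {1..m}" for i j
  proof (rule linear_equation_imp_commuting_congruences[OF Qc C[OF i] C[OF j]])
    show "C i * (Q * Q) * C j = C j * (Q * Q) * C i"
      unfolding Q(3) using eq[of i j] eq[of j i] i j by (cases i j rule: linorder_cases) auto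
  qed
  then have "pairwise_commute m (\<lambda>i. Q * C i * Q)" unfolding pairwise_commute_def by blast
  with Q show ?thesis by blast
qed

text \<open>The matrices $Q C_i Q$ are Hermitian and commute, so one unitary $U$ diagonalizes them all;
  the congruence by $Q U$ then diagonalizes the $C_i$.\<close>
lemma commuting_congruences_imp_SDC:
  fixes C :: "nat \<Rightarrow> complex mat"
  assumes K: "K = \<real> \<or> K = UNIV"
    and C: "\<And>i. i \<in> {1..m} \<Longrightarrow> C i \<in> carrier_mat n n"
      "\<And>i. i \<in> {1..m} \<Longrightarrow> hermitian_mat (C i)"
      "\<And>i. i \<in> {1..m} \<Longrightarrow> elements_mat (C i) \<subseteq> K"
    and Q: "elements_mat Q \<subseteq> K" "positive_definite_mat n Q"
    and comm: "pairwise_commute m (\<lambda>i. Q * C i * Q)"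
  shows "\<exists>P. elements_mat P \<subseteq> K \<and> diagonalizing_congruence n m C P"
proof -
  have Qc: "Q \<in> carrier_mat n n" and Qh: "mat_adjoint Q = Q"
    using Q(2) by (auto simp: positive_definite_mat_def hermitian_mat_def)
  have QC: "Q * C i * Q \<in> carrier_mat n n" "hermitian_mat (Q * C i * Q)" "elements_mat (Q * C i * Q) \<subseteq> K"
    if i: "i \<in> {1..m}" for i
  proof -
    show "Q * C i * Q \<in> carrier_mat n n" using Qc C(1)[OF i] by simp
    show "hermitian_mat (Q * C i * Q)"
      using hermitian_congruence[OF C(1,2)[OF i] Qc] unfolding Qh .
    show "elements_mat (Q * C i * Q) \<subseteq> K"
      using Qc Q(1) C(1,3)[OF i] by (intro elements_mult_subset[OF K, of _ n]) simp_all
  qed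
  have comm': "(Q * C i * Q) * (Q * C j * Q) = (Q * C j * Q) * (Q * C i * Q)"
    if "i \<in> {1..m}" "j \<in> {1..m}" for i j
    using comm that unfolding pairwise_commute_def by blast
  obtain U where U: "U \<in> carrier_mat n n" "elements_mat U \<subseteq> K" "mat_adjoint U * U = 1\<^sub>m n"
      "U * mat_adjoint U = 1\<^sub>m n"
      "\<And>i. i \<in> {1..m} \<Longrightarrow> diagonal_mat (mat_adjoint U * (Q * C i * Q) * U)"
    using simultaneous_unitary_diagonalization[where A = "\<lambda>i. Q * C i * Q",
        OF K finite_atLeastAtMost QC comm'] by blast
  note U' = mat_adjoint_carrier[OF U(1)]
  have "diagonal_mat (mat_adjoint (Q * U) * C i * (Q * U))" if i: "i \<in> {1..m}" for i
  proof -
    have "mat_adjoint (Q * U) * C i * (Q * U) = mat_adjoint U * (Q * C i * Q) * U"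
      unfolding mat_adjoint_mult[OF Qc U(1)] Qh
      using U(1) U' Qc C(1)[OF i] by (simp add: assoc_mult_mat[of _ n n _ n _ n])
    then show ?thesis using U(5)[OF i] by simp
  qed
  moreover have "invertible_mat (Q * U)"
    using invertible_mat_mult[OF Qc positive_definite_invertible[OF Q(2)] U(1)
        invertible_matI[OF U(1) U' U(4,3)]] .
  ultimately have "diagonalizing_congruence n m C (Q * U)"
    unfolding diagonalizing_congruence_def using Qc U(1) by simp
  then show ?thesis using elements_mult_subset[OF K Qc U(1) Q(1) U(2)] by blast
qed

text \<open>The implications form a cycle: diagonal matrices commute; $X = P P^*$ solves the linear system;
  $Q = X^{1/2}$ makes the congruences commute; and these are simultaneously diagonalized.\<close>
lemma SDC_equivalences_over:
  fixes C :: "nat \<Rightarrow> complex mat"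
  assumes K: "K = \<real> \<or> K = UNIV"
    and C: "\<And>i. i \<in> {1..m} \<Longrightarrow> C i \<in> carrier_mat n n"
      "\<And>i. i \<in> {1..m} \<Longrightarrow> hermitian_mat (C i)"
      "\<And>i. i \<in> {1..m} \<Longrightarrow> elements_mat (C i) \<subseteq> K"
  shows "(\<exists>P. elements_mat P \<subseteq> K \<and> diagonalizing_congruence n m C P) \<longleftrightarrow>
         (\<exists>P\<in>carrier_mat n n. elements_mat P \<subseteq> K \<and> invertible_mat P \<and>
            pairwise_commute m (\<lambda>i. mat_adjoint P * C i * P))" (is "?c1 \<longleftrightarrow> ?c2")
    and "(\<exists>P\<in>carrier_mat n n. elements_mat P \<subseteq> K \<and> invertible_mat P \<and>
            pairwise_commute m (\<lambda>i. mat_adjoint P * C i * P)) \<longleftrightarrow>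
         (\<exists>Q. elements_mat Q \<subseteq> K \<and> positive_definite_mat n Q \<and>
            pairwise_commute m (\<lambda>i. Q * C i * Q))" (is "_ \<longleftrightarrow> ?c3")
    and "(\<exists>Q. elements_mat Q \<subseteq> K \<and> positive_definite_mat n Q \<and>
            pairwise_commute m (\<lambda>i. Q * C i * Q)) \<longleftrightarrow>
         (\<exists>X. elements_mat X \<subseteq> K \<and> positive_definite_mat n X \<and>
            (\<forall>i j. 1 \<le> i \<and> i < j \<and> j \<le> m \<longrightarrow> C i * X * C j = C j * X * C i))" (is "_ \<longleftrightarrow> ?c4")
proof -
  have 12: ?c2 if ?c1
  proof -
    from that obtain P where P: "elements_mat P \<subseteq> K" "diagonalizing_congruence n m C P" by blast
    then have "pairwise_commute m (\<lambda>i. mat_adjoint P * C i * P)"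
      using C(1) by (intro SDC_imp_commuting_congruences)
    with P show ?thesis unfolding diagonalizing_congruence_def by (intro bexI[of _ P]) simp_all
  qed
  have 24: ?c4 if ?c2
  proof -
    from that obtain P where "P \<in> carrier_mat n n" "elements_mat P \<subseteq> K" "invertible_mat P"
      "pairwise_commute m (\<lambda>i. mat_adjoint P * C i * P)" by blast
    with K C(1) show ?thesis by (intro commuting_congruences_imp_positive_definite_solution)
  qed
  have 43: ?c3 if ?c4
  proof -
    from that obtain X where X: "elements_mat X \<subseteq> K" "positive_definite_mat n X"
      "\<forall>i j. 1 \<le> i \<and> i < j \<and> j \<le> m \<longrightarrow> C i * X * C j = C j * X * C i" by blast
    show ?thesis
      by (rule positive_definite_solution_imp_commuting_congruences[OF K C(1) X(1,2)])
        (use X(3) in blast)+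
  qed
  have 31: ?c1 if ?c3
  proof -
    from that obtain Q where "elements_mat Q \<subseteq> K" "positive_definite_mat n Q"
      "pairwise_commute m (\<lambda>i. Q * C i * Q)" by blast
    with K C show ?thesis by (intro commuting_congruences_imp_SDC)
  qed
  show "?c1 \<longleftrightarrow> ?c2" by (rule iffI, erule 12, rule 31, rule 43, erule 24)
  show "?c2 \<longleftrightarrow> ?c3" by (rule iffI, rule 43, erule 24, rule 12, erule 31)
  show "?c3 \<longleftrightarrow> ?c4" by (rule iffI, rule 24, rule 12, erule 31, erule 43)
qed

section \<open>From complex to real solutions\<close>

text \<open>The linear system has real coefficients and the positive definite matrices form a convex cone
  that is closed under conjugation, so $X + \bar X$ is a real solution.\<close>
lemma real_positive_definite_solution:
  fixes C :: "nat \<Rightarrow> complex mat"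
  assumes C: "\<And>i. i \<in> {1..m} \<Longrightarrow> C i \<in> carrier_mat n n"
      "\<And>i. i \<in> {1..m} \<Longrightarrow> real_mat (C i)"
    and X: "positive_definite_mat n X"
    and eq: "\<And>i j. 1 \<le> i \<Longrightarrow> i < j \<Longrightarrow> j \<le> m \<Longrightarrow> C i * X * C j = C j * X * C i"
  shows "\<exists>Y. real_mat Y \<and> positive_definite_mat n Y \<and>
           (\<forall>i j. 1 \<le> i \<and> i < j \<and> j \<le> m \<longrightarrow> C i * Y * C j = C j * Y * C i)"
proof (intro exI conjI allI impI)
  have Xc: "X \<in> carrier_mat n n" and Xh: "mat_adjoint X = X"
    and Xp: "\<And>v. v \<in> carrier_vec n \<Longrightarrow> v \<noteq> 0\<^sub>v n \<Longrightarrow> 0 < (X *\<^sub>v v) \<bullet>c v"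
    using X by (auto simp: positive_definite_mat_def hermitian_mat_def)
  define Z where "Z = map_mat cnj X"
  have Zc: "Z \<in> carrier_mat n n" using Xc by (simp add: Z_def)
  have herm: "cnj (X $$ (j,i)) = X $$ (i,j)" if "i < n" "j < n" for i j
    using mat_adjoint_index[OF Xc that] by (simp add: Xh)
  show "real_mat (X + Z)"
    unfolding real_mat_def elements_mat_subset_iff[OF add_carrier_mat[OF Zc]]
    using Xc by (auto simp: Z_def complex_add_cnj)
  show "positive_definite_mat n (X + Z)"
    unfolding positive_definite_mat_def
  proof (intro conjI ballI impI)
    show "X + Z \<in> carrier_mat n n" using Zc by simp
    show "hermitian_mat (X + Z)"
      unfolding hermitian_mat_def
    proof (rule eq_matI)
      fix i j assume "i < dim_row (X + Z)" "j < dim_col (X + Z)"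
      then have ij: "i < n" "j < n" using Zc by auto
      show "mat_adjoint (X + Z) $$ (i,j) = (X + Z) $$ (i,j)"
        unfolding mat_adjoint_index[OF add_carrier_mat[OF Zc] ij]
        using ij Xc herm[OF ij] herm[OF ij(2,1)] by (simp add: Z_def)
    qed (use mat_adjoint_carrier[OF add_carrier_mat[OF Zc, of X]] Zc in auto)
    fix v :: "complex vec" assume v: "v \<in> carrier_vec n" "v \<noteq> 0\<^sub>v n"
    \<comment> \<open>The form of $\bar X$ at $v$ is the conjugate of the form of $X$ at $\bar v$.\<close>
    have Zv: "Z *\<^sub>v v = conjugate (X *\<^sub>v conjugate v)"
      using Xc v(1) by (intro eq_vecI) (auto simp: Z_def scalar_prod_def)
    have "0 < (X *\<^sub>v conjugate v) \<bullet>c conjugate v"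
      using v by (intro Xp) auto
    also have "\<dots> = cnj ((X *\<^sub>v conjugate v) \<bullet>c conjugate v)"
      using calculation by (simp add: less_complex_def complex_eq_iff)
    also have "\<dots> = (Z *\<^sub>v v) \<bullet>c v"
      unfolding Zv using Xc v(1) by (simp add: scalar_prod_def)
    finally have "0 < (Z *\<^sub>v v) \<bullet>c v" .
    moreover have "((X + Z) *\<^sub>v v) \<bullet>c v = (X *\<^sub>v v) \<bullet>c v + (Z *\<^sub>v v) \<bullet>c v"
      using Xc Zc v(1) by (simp add: add_mult_distrib_mat_vec[of _ n n] add_scalar_prod_distrib[of _ n])
    ultimately show "0 < ((X + Z) *\<^sub>v v) \<bullet>c v" using Xp[OF v] by (simp add: add_pos_pos)
  qed
  fix i j assume ij: "1 \<le> i \<and> i < j \<and> j \<le> m"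
  then have i: "i \<in> {1..m}" and j: "j \<in> {1..m}" by auto
  have cnj_mult: "map_mat cnj (A * B) = map_mat cnj A * map_mat cnj B"
    if "A \<in> carrier_mat n n" "B \<in> carrier_mat n n" for A B
    using that by (intro eq_matI) (auto simp: scalar_prod_def)
  have real: "map_mat cnj (C k) = C k" if "k \<in> {1..m}" for k
    using C(2)[OF that] C(1)[OF that] unfolding real_mat_def elements_mat_subset_iff[OF C(1)[OF that]]
    by (intro eq_matI) (auto simp: Reals_cnj_iff)
  have conj: "map_mat cnj (C k * X * C l) = C k * Z * C l" if "k \<in> {1..m}" "l \<in> {1..m}" for k l
    using cnj_mult[of "C k * X" "C l"] cnj_mult[of "C k" X] C(1)[OF that(1)] C(1)[OF that(2)] Xc
    by (simp add: real[OF that(1)] real[OF that(2)] Z_def)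
  have "C i * X * C j = C j * X * C i" using eq ij by blast
  moreover from this have "C i * Z * C j = C j * Z * C i" using conj[OF i j] conj[OF j i] by simp
  moreover have "C k * (X + Z) * C l = C k * X * C l + C k * Z * C l"
    if "k \<in> {1..m}" "l \<in> {1..m}" for k l
    using C(1)[OF that(1)] C(1)[OF that(2)] Xc Zc
    by (simp add: mult_add_distrib_mat[of _ n n] add_mult_distrib_mat[of _ n n])
  ultimately show "C i * (X + Z) * C j = C j * (X + Z) * C i" using i j by simp
qed

section \<open>The equivalence\<close>

theorem theorem7:
  fixes n m :: nat and C :: "nat \<Rightarrow> complex mat"
  assumes "\<And>i. i \<in> {1..m} \<Longrightarrow> C i \<in> carrier_mat n n"
    and "\<And>i. i \<in> {1..m} \<Longrightarrow> hermitian_mat (C i)"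
  shows
    "let
       c1 = SDC n m C;
       c2 = (\<exists>P \<in> carrier_mat n n. invertible_mat P \<and>
               pairwise_commute m (\<lambda>i. mat_adjoint P * C i * P));
       c3 = (\<exists>Q. positive_definite_mat n Q \<and> pairwise_commute m (\<lambda>i. Q * C i * Q));
       c4 = (\<exists>X. positive_definite_mat n X \<and>
               (\<forall>i j. 1 \<le> i \<and> i < j \<and> j \<le> m \<longrightarrow> C i * X * C j = C j * X * C i));
       r1 = (\<exists>P. real_mat P \<and> diagonalizing_congruence n m C P);
       r2 = (\<exists>P \<in> carrier_mat n n. real_mat P \<and> invertible_mat P \<and>
               pairwise_commute m (\<lambda>i. mat_adjoint P * C i * P));
       r3 = (\<exists>Q. real_mat Q \<and> positive_definite_mat n Q \<and>
               pairwise_commute m (\<lambda>i. Q * C i * Q));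
       r4 = (\<exists>X. real_mat X \<and> positive_definite_mat n X \<and>
               (\<forall>i j. 1 \<le> i \<and> i < j \<and> j \<le> m \<longrightarrow> C i * X * C j = C j * X * C i))
     in
       (c1 \<longleftrightarrow> c2) \<and> (c2 \<longleftrightarrow> c3) \<and> (c3 \<longleftrightarrow> c4) \<and>
       ((\<forall>i \<in> {1..m}. real_mat (C i)) \<longrightarrow>
          (r1 \<longleftrightarrow> r2) \<and> (r2 \<longleftrightarrow> r3) \<and> (r3 \<longleftrightarrow> r4) \<and>
          (r1 \<longleftrightarrow> c1) \<and> (r2 \<longleftrightarrow> c2) \<and> (r3 \<longleftrightarrow> c3) \<and> (r4 \<longleftrightarrow> c4))"
proof -
  define c1 where "c1 = SDC n m C"
  define c2 where "c2 = (\<exists>P \<in> carrier_mat n n. invertible_mat P \<and>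
               pairwise_commute m (\<lambda>i. mat_adjoint P * C i * P))"
  define c3 where "c3 = (\<exists>Q. positive_definite_mat n Q \<and> pairwise_commute m (\<lambda>i. Q * C i * Q))"
  define c4 where "c4 = (\<exists>X. positive_definite_mat n X \<and>
               (\<forall>i j. 1 \<le> i \<and> i < j \<and> j \<le> m \<longrightarrow> C i * X * C j = C j * X * C i))"
  define r1 where "r1 = (\<exists>P. real_mat P \<and> diagonalizing_congruence n m C P)"
  define r2 where "r2 = (\<exists>P \<in> carrier_mat n n. real_mat P \<and> invertible_mat P \<and>
               pairwise_commute m (\<lambda>i. mat_adjoint P * C i * P))"
  define r3 where "r3 = (\<exists>Q. real_mat Q \<and> positive_definite_mat n Q \<and>
               pairwise_commute m (\<lambda>i. Q * C i * Q))"
  define r4 where "r4 = (\<exists>X. real_mat X \<and> positive_definite_mat n X \<and>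
               (\<forall>i j. 1 \<le> i \<and> i < j \<and> j \<le> m \<longrightarrow> C i * X * C j = C j * X * C i))"
  have c: "c1 \<longleftrightarrow> c2" "c2 \<longleftrightarrow> c3" "c3 \<longleftrightarrow> c4"
  proof -
    note over = SDC_equivalences_over[of UNIV m C n, OF disjI2[OF refl] assms subset_UNIV,
        simplified subset_UNIV simp_thms]
    show "c1 \<longleftrightarrow> c2" unfolding c1_def c2_def SDC_def by (rule over(1)) simp_all
    show "c2 \<longleftrightarrow> c3" unfolding c2_def c3_def by (rule over(2)) simp_all
    show "c3 \<longleftrightarrow> c4" unfolding c3_def c4_def by (rule over(3)) simp_all
  qed
  have r: "(r1 \<longleftrightarrow> r2) \<and> (r2 \<longleftrightarrow> r3) \<and> (r3 \<longleftrightarrow> r4) \<and> (r4 \<longleftrightarrow> c4)"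
    if real: "\<forall>i \<in> {1..m}. real_mat (C i)"
  proof -
    have CR: "elements_mat (C i) \<subseteq> \<real>" if "i \<in> {1..m}" for i
      using real that by (simp add: real_mat_def)
    note over = SDC_equivalences_over[of \<real> m C n, OF disjI1[OF refl] assms CR]
    have "r1 \<longleftrightarrow> r2" unfolding r1_def r2_def real_mat_def by (rule over(1))
    moreover have "r2 \<longleftrightarrow> r3" unfolding r2_def r3_def real_mat_def by (rule over(2))
    moreover have "r3 \<longleftrightarrow> r4" unfolding r3_def r4_def real_mat_def by (rule over(3))
    moreover have "r4" if c4
    proof -
      from that[unfolded c4_def] obtain X where X: "positive_definite_mat n X"
        "\<forall>i j. 1 \<le> i \<and> i < j \<and> j \<le> m \<longrightarrow> C i * X * C j = C j * X * C i"
        by blast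
      show ?thesis unfolding r4_def
        by (rule real_positive_definite_solution[OF assms(1) _ X(1)]) (use real X(2) in blast)+
    qed
    moreover have "r4 \<Longrightarrow> c4" unfolding c4_def r4_def by blast
    ultimately show ?thesis by argo
  qed
  show ?thesis
    unfolding Let_def c1_def[symmetric] c2_def[symmetric] c3_def[symmetric] c4_def[symmetric]
      r1_def[symmetric] r2_def[symmetric] r3_def[symmetric] r4_def[symmetric]
    using c r by argo
qed

end
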